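(* Let $\rho$ be as in the context with $\psi_*>0$, and let the observations $y_i=\mu_\circ+\sigma_\circ\varepsilon_i$, $i=1,\dots,n$, with `good' index sets $\zeta_n$, $|\zeta_n|=h$, be as in the context, where $h/n\to\lambda$ with $1/2<\lambda<1$. Suppose: (i) $\hat\sigma=\sigma_\circ$; (ii) the `good' errors $\varepsilon_i$, $i\in\zeta_n$, are independent standard normal; (iii) $h^{-1}\sum_{i\in\zeta_n}\rho(\varepsilon_i-\mu)\to\mathsf{E}\rho(\varepsilon_1-\mu)$ in probability, uniformly over a $\mu$-neighbourhood of zero, where $\varepsilon_1$ denotes a generic `good' (standard normal) error; (iv) the function $\mu\mapsto\mathsf{E}\rho(\varepsilon_1-\mu)$ has derivative $0$ at $\mu=0$; (v) the `outlier' errors satisfy $\varepsilon_j=\max_{i\in\zeta_n}\varepsilon_i+\xi$ for all $j\in\zeta_n^c$, for some $\xi>0$. Let $\hat\mu$ be a minimizer over $\mu\in\mathbb{R}$ of $R_n(\mu)=\sum_{i=1}^n\rho\{(y_i-\mu)/\hat\sigma\}$. Then $\hat\mu$ is inconsistent for $\mu_\circ$, that is, $\hat\mu$ does not converge in probability to $\mu_\circ$ as $n\to\infty$.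
   Context: Asymptotic setting. Models are indexed by $n$. For each $n$ there are scalar observations $y_i=\mu_\circ+\sigma_\circ\varepsilon_i$, $i=1,\dots,n$, with fixed $\mu_\circ\in\mathbb{R}$, $\sigma_\circ>0$ and random errors $\varepsilon_i$. There are $h\le n$ `good' observations and $n-h$ `outliers', with $h\to\infty$ as $n\to\infty$ and $h/n\to\lambda$. The set $\zeta_n\subset\{1,\dots,n\}$, $|\zeta_n|=h$, of indices of `good' observations is a deterministic sequence; $\zeta_n^c$ is its complement in $\{1,\dots,n\}$ (indices of `outliers'). Condition on $\rho$. The function $\rho:\mathbb{R}\to\mathbb{R}$ satisfies $\rho(0)=0$, $\rho(x)>0$ for $x\neq 0$, is continuous, symmetric, and non-decreasing in $x>0$, and there are $x_*,\rho_*>0$ and $\psi_*\ge 0$ such that $\rho(x)=\rho_*+\psi_*(|x|-x_* )$ for $|x|\ge x_*$. *)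

theory Defs
  imports "HOL-Probability.Probability"
begin

definition rho_condition :: "(real \<Rightarrow> real) \<Rightarrow> real \<Rightarrow> real \<Rightarrow> real \<Rightarrow> bool" where
  "rho_condition \<rho> x_st rho_st psi_st \<longleftrightarrow>
     \<rho> 0 = 0 \<and> (\<forall>x. x \<noteq> 0 \<longrightarrow> \<rho> x > 0) \<and>
     continuous_on UNIV \<rho> \<and> (\<forall>x. \<rho> (- x) = \<rho> x) \<and> mono_on {0<..} \<rho> \<and>
     x_st > 0 \<and> rho_st > 0 \<and> psi_st \<ge> 0 \<and>
     (\<forall>x. \<bar>x\<bar> \<ge> x_st \<longrightarrow> \<rho> x = rho_st + psi_st * (\<bar>x\<bar> - x_st))"

definition m_objective :: "(real \<Rightarrow> real) \<Rightarrow> nat \<Rightarrow> (nat \<Rightarrow> real) \<Rightarrow> real \<Rightarrow> real \<Rightarrow> real" where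
  "m_objective \<rho> n y s \<mu> = (\<Sum>i=1..n. \<rho> ((y i - \<mu>) / s))"

text \<open>Every model in the sequence may live on its own probability space \<open>M n\<close>.\<close>

definition conv_in_prob :: "(nat \<Rightarrow> 'a measure) \<Rightarrow> (nat \<Rightarrow> 'a \<Rightarrow> real) \<Rightarrow> real \<Rightarrow> bool" where
  "conv_in_prob M X c \<longleftrightarrow>
     (\<forall>e>0. (\<lambda>n. measure (M n) {\<omega> \<in> space (M n). \<bar>X n \<omega> - c\<bar> > e}) \<longlonglongrightarrow> 0)"

text \<open>The supremum is taken in the extended reals, so that it is meaningful without a
  boundedness assumption. If \<open>g\<close> and the paths \<open>\<lambda>u. G n u \<omega>\<close> are continuous and each
  \<open>G n u\<close> is measurable, the supremum reduces to a countable one, hence the event is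
  measurable.\<close>

definition unif_conv_in_prob ::
  "(nat \<Rightarrow> 'a measure) \<Rightarrow> real set \<Rightarrow> (nat \<Rightarrow> real \<Rightarrow> 'a \<Rightarrow> real) \<Rightarrow> (real \<Rightarrow> real) \<Rightarrow> bool" where
  "unif_conv_in_prob M U G g \<longleftrightarrow>
     (\<forall>e>0. (\<lambda>n. measure (M n)
        {\<omega> \<in> space (M n). (SUP u\<in>U. ereal \<bar>G n u \<omega> - g u\<bar>) > ereal e}) \<longlonglongrightarrow> 0)"

end

theory Submission
  imports Defs
begin

text \<open>
  In the standardised parameter \<open>u = (\<mu> - \<mu>\<^sub>0) / \<sigma>\<^sub>0\<close> compare the objective at the minimizer
  \<open>u\<^sub>h\<close> with its value at a small fixed \<open>u\<^sub>1 > 0\<close>. With high probability all outliers lie in the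
  region where \<open>\<rho>\<close> is linear, so moving from \<open>u\<^sub>h\<close> to \<open>u\<^sub>1\<close> lowers their contribution by exactly
  \<open>(n - h) \<psi> (u\<^sub>1 - u\<^sub>h)\<close>. If \<open>u\<^sub>h\<close> were close to 0, this gain would be of order \<open>n u\<^sub>1\<close>, whereas
  the good observations lose only \<open>n o(u\<^sub>1)\<close> because the derivative of the expected loss vanishes
  at 0. This contradicts minimality.
\<close>

section \<open>Regularity of the loss and of its Gaussian expectation\<close>

text \<open>The loss splits into its restriction to a compact interval, where continuity is
  automatically uniform, and a Lipschitz tail. Uniformity over all \<open>x\<close> later allows
  shifts of the argument to be controlled whatever the values of the errors.\<close>

lemma rho_uniformly_continuous:
  assumes "rho_condition \<rho> x_st rho_st psi_st"
  shows "uniformly_continuous_on UNIV \<rho>"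
proof -
  have cont: "continuous_on UNIV \<rho>" and xst: "x_st > 0" and psi: "psi_st \<ge> 0"
    and lin: "\<bar>x\<bar> \<ge> x_st \<Longrightarrow> \<rho> x = rho_st + psi_st * (\<bar>x\<bar> - x_st)" for x
    using assms by (auto simp: rho_condition_def)
  \<comment> \<open>\<open>c\<close> clips to \<open>[-x_st, x_st]\<close> and \<open>l\<close> is
    the linear excess beyond it. They add up to the loss because its value at both endpoints is
    \<open>rho_st\<close>.\<close>
  define c where "c x = max (- x_st) (min x_st x)" for x :: real
  define l where "l x = psi_st * max 0 (\<bar>x\<bar> - x_st)" for x :: real
  have decomp: "\<rho> x = \<rho> (c x) + l x" for x
    using lin[of x] lin[of x_st] lin[of "- x_st"] xst
    by (cases "x \<ge> x_st"; cases "x \<le> - x_st") (simp_all add: c_def l_def max_def min_def)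
  have c_lip: "\<bar>c x - c y\<bar> \<le> \<bar>x - y\<bar>" for x y
    by (auto simp: c_def)
  have l_lip: "\<bar>l x - l y\<bar> \<le> psi_st * \<bar>x - y\<bar>" for x y
  proof -
    have "\<bar>l x - l y\<bar> = psi_st * \<bar>max 0 (\<bar>x\<bar> - x_st) - max 0 (\<bar>y\<bar> - x_st)\<bar>"
      using psi by (simp add: l_def abs_mult flip: right_diff_distrib)
    also have "\<dots> \<le> psi_st * \<bar>x - y\<bar>"
      by (intro mult_left_mono psi) auto
    finally show ?thesis .
  qed
  have unif: "uniformly_continuous_on {-x_st..x_st} \<rho>"
    by (intro compact_uniformly_continuous continuous_on_subset[OF cont]) auto
  show ?thesis
    unfolding uniformly_continuous_on_def
  proof (intro allI impI)
    fix e :: real assume "e > 0"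
    then obtain d where d: "d > 0"
      "\<And>x y. x \<in> {-x_st..x_st} \<Longrightarrow> y \<in> {-x_st..x_st} \<Longrightarrow> dist y x < d \<Longrightarrow> dist (\<rho> y) (\<rho> x) < e/2"
      using unif unfolding uniformly_continuous_on_def by (meson half_gt_zero)
    \<comment> \<open>The \<open>+ 1\<close> keeps the denominator positive, since
      \<open>psi_st = 0\<close> is allowed here.\<close>
    define d' where "d' = min d (e / (2 * (psi_st + 1)))"
    have "d' > 0" using d \<open>e > 0\<close> psi by (simp add: d'_def)
    moreover have "dist (\<rho> y) (\<rho> x) < e" if "dist y x < d'" for x y
    proof -
      have "\<bar>\<rho> (c y) - \<rho> (c x)\<bar> < e/2"
        using d(2)[of "c x" "c y"] that c_lip[of y x] xst
        by (auto simp: dist_real_def d'_def) (auto simp: c_def)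
      moreover have "\<bar>l y - l x\<bar> \<le> e/2"
      proof -
        have "\<bar>l y - l x\<bar> \<le> (psi_st + 1) * \<bar>y - x\<bar>"
          using l_lip[of y x] by (simp add: algebra_simps)
        also have "\<dots> \<le> (psi_st + 1) * (e / (2 * (psi_st + 1)))"
          using that psi by (intro mult_left_mono) (auto simp: dist_real_def d'_def)
        also have "\<dots> = e/2" using psi by (simp add: field_simps)
        finally show ?thesis .
      qed
      ultimately show ?thesis
        unfolding dist_real_def decomp[of x] decomp[of y] by linarith
    qed
    ultimately show "\<exists>d>0. \<forall>x\<in>UNIV. \<forall>x'\<in>UNIV. dist x' x < d \<longrightarrow> dist (\<rho> x') (\<rho> x) < e"
      by blast
  qed
qed

text \<open>Monotonicity caps the loss by \<open>rho_st\<close> for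
  \<open>\<bar>x\<bar> < x_st\<close>; beyond that the linear formula only has to drop
  \<open>- psi_st * x_st\<close>. The bound makes the shifted loss integrable under the normal
  law.\<close>

lemma rho_affine_bound:
  assumes "rho_condition \<rho> x_st rho_st psi_st"
  shows "\<bar>\<rho> x\<bar> \<le> rho_st + psi_st * \<bar>x\<bar>"
proof -
  have zero: "\<rho> 0 = 0" and pos: "x \<noteq> 0 \<Longrightarrow> \<rho> x > 0"
    and mono: "mono_on {0<..} \<rho>" and xst: "x_st > 0" and nonneg: "psi_st \<ge> 0" "rho_st > 0"
    and sym: "\<rho> (- x) = \<rho> x"
    and lin: "\<bar>x\<bar> \<ge> x_st \<Longrightarrow> \<rho> x = rho_st + psi_st * (\<bar>x\<bar> - x_st)" for x
    using assms by (auto simp: rho_condition_def)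
  have "\<rho> \<bar>x\<bar> \<le> rho_st + psi_st * \<bar>x\<bar>"
  proof (cases "\<bar>x\<bar> \<ge> x_st")
    case True
    have "psi_st * (\<bar>x\<bar> - x_st) \<le> psi_st * \<bar>x\<bar>"
      using nonneg xst by (intro mult_left_mono) auto
    then show ?thesis using lin[of "\<bar>x\<bar>"] True by simp
  next
    case False
    have "\<rho> \<bar>x\<bar> \<le> rho_st"
    proof (cases "x = 0")
      case False
      have "\<rho> \<bar>x\<bar> \<le> \<rho> x_st"
        using False xst \<open>\<not> \<bar>x\<bar> \<ge> x_st\<close> by (intro mono_onD[OF mono]) auto
      then show ?thesis using lin[of x_st] xst by simp
    qed (use zero nonneg in simp)
    moreover have "psi_st * \<bar>x\<bar> \<ge> 0" using nonneg by simp
    ultimately show ?thesis by linarith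
  qed
  moreover have "\<rho> \<bar>x\<bar> = \<rho> x" using sym[of x] by (cases "x \<ge> 0") auto
  moreover have "\<rho> x \<ge> 0" using zero pos by (cases "x = 0") (auto intro: less_imp_le)
  ultimately show ?thesis by simp
qed

lemma integrable_std_normal_affine_bound:
  fixes f :: "real \<Rightarrow> real"
  assumes [measurable]: "f \<in> borel_measurable borel"
    and bound: "\<And>x. \<bar>f x\<bar> \<le> a + b * \<bar>x\<bar>"
  shows "integrable std_normal_distribution f"
proof -
  interpret N: prob_space std_normal_distribution
    by (rule prob_space_normal_density) simp
  have "integrable std_normal_distribution (\<lambda>x. \<bar>x\<bar> ^ k)" for k :: nat
    using integrable_std_normal_moment_abs[of k] by (simp add: integrable_density)
  from this[of 1] have "integrable std_normal_distribution (\<lambda>x. a + b * \<bar>x\<bar>)"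
    by (intro Bochner_Integration.integrable_add integrable_mult_right N.integrable_const) simp
  then show ?thesis
    by (rule Bochner_Integration.integrable_bound)
       (use bound in \<open>auto intro: order_trans[OF bound abs_ge_self]\<close>)
qed

text \<open>A small shift changes the integrand by at most \<open>e/2\<close> at every point, and
  integration against a probability measure preserves this bound. Continuity serves the
  measurability of the supremum event.\<close>

lemma expected_rho_continuous:
  assumes rho: "rho_condition \<rho> x_st rho_st psi_st"
  shows "continuous_on UNIV (\<lambda>u. LINT x|std_normal_distribution. \<rho> (x - u))"
proof -
  interpret N: prob_space std_normal_distribution
    by (rule prob_space_normal_density) simp
  have cont: "continuous_on UNIV \<rho>" and psi: "psi_st \<ge> 0" using rho by (auto simp: rho_condition_def)
  have [measurable]: "\<rho> \<in> borel_measurable borel"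
    by (rule borel_measurable_continuous_onI[OF cont])
  have int: "integrable std_normal_distribution (\<lambda>x. \<rho> (x - u))" for u
  proof (rule integrable_std_normal_affine_bound)
    fix x
    have "psi_st * \<bar>x - u\<bar> \<le> psi_st * (\<bar>x\<bar> + \<bar>u\<bar>)"
      using psi by (intro mult_left_mono) auto
    then show "\<bar>\<rho> (x - u)\<bar> \<le> (rho_st + psi_st * \<bar>u\<bar>) + psi_st * \<bar>x\<bar>"
      using rho_affine_bound[OF rho, of "x - u"] by (simp add: algebra_simps)
  qed simp
  show ?thesis
    unfolding continuous_on_iff
  proof (intro ballI allI impI)
    fix u e :: real assume "e > 0"
    then obtain d where d: "d > 0" "\<And>x y. dist y x < d \<Longrightarrow> dist (\<rho> y) (\<rho> x) < e/2"
      using rho_uniformly_continuous[OF rho] unfolding uniformly_continuous_on_def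
      by (metis UNIV_I half_gt_zero)
    have "dist (LINT x|std_normal_distribution. \<rho> (x - v)) (LINT x|std_normal_distribution. \<rho> (x - u)) < e"
      if "dist v u < d" for v
    proof -
      have close: "\<bar>\<rho> (x - v) - \<rho> (x - u)\<bar> \<le> e/2" for x
        using d(2)[of "x - v" "x - u"] that by (simp add: dist_real_def abs_minus_commute)
      have "\<bar>LINT x|std_normal_distribution. \<rho> (x - v) - \<rho> (x - u)\<bar>
          \<le> (LINT x|std_normal_distribution. \<bar>\<rho> (x - v) - \<rho> (x - u)\<bar>)"
        by (rule integral_abs_bound)
      also have "\<dots> \<le> e/2"
        by (rule N.integral_le_const)
           (rule integrable_abs Bochner_Integration.integrable_diff int AE_I2 close)+
      also have "\<dots> < e" using \<open>e > 0\<close> by simp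
      finally show ?thesis using int by (simp add: dist_real_def)
    qed
    then show "\<exists>d>0. \<forall>v\<in>UNIV. dist v u < d \<longrightarrow>
        dist (LINT x|std_normal_distribution. \<rho> (x - v)) (LINT x|std_normal_distribution. \<rho> (x - u)) < e"
      using d(1) by blast
  qed
qed

section \<open>From uniform to pointwise convergence in probability\<close>

text \<open>For fixed \<open>\<omega>\<close> the parameters with deviation above \<open>e\<close>
  form an open set, which contains a rational as soon as it is nonempty. So the event is a countable
  union.\<close>

lemma SUP_event_measurable:
  fixes G :: "real \<Rightarrow> 'a \<Rightarrow> real"
  assumes "open U"
    and G [measurable]: "\<And>u. G u \<in> borel_measurable M"
    and Gc: "\<And>\<omega>. \<omega> \<in> space M \<Longrightarrow> continuous_on U (\<lambda>u. G u \<omega>)"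
    and gc: "continuous_on U g"
  shows "{\<omega> \<in> space M. (SUP u\<in>U. ereal \<bar>G u \<omega> - g u\<bar>) > ereal e} \<in> sets M"
proof -
  have "{\<omega> \<in> space M. (SUP u\<in>U. ereal \<bar>G u \<omega> - g u\<bar>) > ereal e}
      = (\<Union>u\<in>U \<inter> \<rat>. {\<omega> \<in> space M. \<bar>G u \<omega> - g u\<bar> > e})" (is "?L = ?R")
  proof (intro set_eqI iffI)
    fix \<omega> assume \<omega>: "\<omega> \<in> ?L"
    define V where "V = U \<inter> (\<lambda>u. \<bar>G u \<omega> - g u\<bar>) -` {e<..}"
    have "open V"
      unfolding V_def using \<omega> \<open>open U\<close> Gc gc
      by (intro continuous_open_preimage continuous_intros) auto
    moreover obtain u where "u \<in> V"
      using \<omega> by (auto simp: less_SUP_iff V_def)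
    ultimately obtain d where "d > 0" and d: "ball u d \<subseteq> V"
      using open_contains_ball by blast
    obtain q where "q \<in> \<rat>" "u < q" "q < u + d"
      using Rats_dense_in_real[of u "u + d"] \<open>d > 0\<close> by auto
    with d have "q \<in> V" by (auto simp: subset_iff dist_real_def)
    with \<open>q \<in> \<rat>\<close> \<omega> show "\<omega> \<in> ?R" by (auto simp: V_def)
  qed (auto simp: less_SUP_iff)
  also have "\<dots> \<in> sets M"
    by (intro sets.countable_UN'' countable_Int2 countable_rat) measurable
  finally show ?thesis .
qed

text \<open>The deviation event at \<open>u\<close> lies inside the supremum event. Measurability of
  the larger event is essential to the comparison: \<open>measure\<close> assigns 0 to
  non-measurable sets.\<close>

lemma unif_conv_in_prob_pointwise:
  assumes conv: "unif_conv_in_prob M U G g" and "u \<in> U" "e > 0"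
    and fin: "\<And>n. finite_measure (M n)"
    and meas: "\<And>n e. {\<omega> \<in> space (M n). (SUP u\<in>U. ereal \<bar>G n u \<omega> - g u\<bar>) > ereal e} \<in> sets (M n)"
  shows "(\<lambda>n. measure (M n) {\<omega> \<in> space (M n). \<bar>G n u \<omega> - g u\<bar> > e}) \<longlonglongrightarrow> 0"
proof (rule tendsto_sandwich[where f = "\<lambda>_. 0"])
  show "(\<lambda>n. measure (M n) {\<omega> \<in> space (M n). (SUP u\<in>U. ereal \<bar>G n u \<omega> - g u\<bar>) > ereal e}) \<longlonglongrightarrow> 0"
    using conv \<open>e > 0\<close> by (simp add: unif_conv_in_prob_def)
  show "\<forall>\<^sub>F n in sequentially. measure (M n) {\<omega> \<in> space (M n). \<bar>G n u \<omega> - g u\<bar> > e}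
      \<le> measure (M n) {\<omega> \<in> space (M n). (SUP u\<in>U. ereal \<bar>G n u \<omega> - g u\<bar>) > ereal e}"
    using \<open>u \<in> U\<close>
    by (intro always_eventually allI finite_measure.finite_measure_mono[OF fin] meas)
       (auto simp: less_SUP_iff)
qed auto

section \<open>The maximum of independent standard normal errors\<close>

text \<open>The density is positive everywhere, so a null upper tail would force
  \<open>{K<..<K+1}\<close> to be Lebesgue null. The strict inequality makes powers of this
  probability vanish.\<close>

lemma std_normal_atMost_less_1: "measure std_normal_distribution {..K} < 1"
proof -
  interpret N: prob_space std_normal_distribution
    by (rule prob_space_normal_density) simp
  have "\<not> (AE x in std_normal_distribution. x \<in> {..K})"
  proof
    assume "AE x in std_normal_distribution. x \<in> {..K}"
    then have "AE x in lborel. x \<in> {..K}"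
      by (simp add: AE_density normal_density_pos)
    then have "emeasure lborel {x. x > K} = 0"
      by (auto dest!: AE_E2[where M = lborel] simp: not_le)
    then have "emeasure lborel {K<..<K+1} = 0"
      by (rule emeasure_eq_0[rotated]) auto
    then show False by simp
  qed
  then show ?thesis
    using N.prob_eq_1[of "{..K}"] N.prob_le_1[of "{..K}"] by fastforce
qed

text \<open>Independence turns the intersection into a product. As \<open>card I\<close> grows the
  power tends to 0, so the largest good error eventually exceeds any fixed \<open>K\<close> with
  high probability.\<close>

lemma prob_all_std_normal_le:
  assumes "prob_space M" "finite I" "I \<noteq> {}"
    and indep: "prob_space.indep_vars M (\<lambda>_. borel) X I"
    and normal: "\<And>i. i \<in> I \<Longrightarrow> distributed M lborel (X i) std_normal_density"
  shows "measure M (\<Inter>i\<in>I. X i -` {..K} \<inter> space M)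
    = measure std_normal_distribution {..K} ^ card I"
proof -
  interpret prob_space M by fact
  have "prob (\<Inter>i\<in>I. X i -` {..K} \<inter> space M) = (\<Prod>i\<in>I. prob (X i -` {..K} \<inter> space M))"
    using assms by (intro indep_varsD[OF indep]) auto
  also have "\<dots> = (\<Prod>i\<in>I. measure std_normal_distribution {..K})"
  proof (rule prod.cong)
    fix i assume "i \<in> I"
    note d = normal[OF this]
    have "measure std_normal_distribution {..K} = measure (distr M lborel (X i)) {..K}"
      using distributed_distr_eq_density[OF d] by simp
    also have "\<dots> = prob (X i -` {..K} \<inter> space M)"
      using distributed_measurable[OF d] by (intro measure_distr) auto
    finally show "prob (X i -` {..K} \<inter> space M) = measure std_normal_distribution {..K}" ..
  qed simp
  finally show ?thesis by simp
qed

section \<open>The contaminated objective and the contradiction to consistency\<close>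

text \<open>Location and scale cancel in the standardised parameter, and the outliers, sharing one
  error \<open>E\<close>, contribute a single weighted term.\<close>

lemma m_objective_standardised:
  assumes "s > 0" and "Z \<subseteq> {1..n}"
    and "\<And>i. i \<in> {1..n} \<Longrightarrow> y i = m + s * e i"
    and "\<And>j. j \<in> {1..n} - Z \<Longrightarrow> e j = E"
  shows "m_objective \<rho> n y s (m + s * u)
    = (\<Sum>i\<in>Z. \<rho> (e i - u)) + (real n - real (card Z)) * \<rho> (E - u)"
proof -
  have fin: "finite Z" using assms(2) finite_subset by blast
  have "card Z \<le> n" using card_mono[OF _ assms(2)] by simp
  have "m_objective \<rho> n y s (m + s * u) = (\<Sum>i=1..n. \<rho> (e i - u))"
    unfolding m_objective_def
  proof (rule sum.cong)
    fix i assume "i \<in> {1..n}"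
    then have "(y i - (m + s * u)) / s = e i - u"
      using assms(1) assms(3)[of i] by (simp add: field_simps)
    then show "\<rho> ((y i - (m + s * u)) / s) = \<rho> (e i - u)" by simp
  qed simp
  also have "\<dots> = (\<Sum>i\<in>{1..n} - Z. \<rho> (e i - u)) + (\<Sum>i\<in>Z. \<rho> (e i - u))"
    by (rule sum.subset_diff) (use assms(2) in auto)
  also have "(\<Sum>i\<in>{1..n} - Z. \<rho> (e i - u)) = (\<Sum>i\<in>{1..n} - Z. \<rho> (E - u))"
    by (rule sum.cong) (auto simp: assms(4))
  also have "\<dots> = (real n - real (card Z)) * \<rho> (E - u)"
    using \<open>card Z \<le> n\<close> card_Diff_subset[OF fin assms(2)] by (simp add: of_nat_diff)
  finally show ?thesis by simp
qed

theorem theorem3p4: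
  fixes M :: "nat \<Rightarrow> 'a measure"
    and eps y :: "nat \<Rightarrow> nat \<Rightarrow> 'a \<Rightarrow> real"
    and \<zeta> :: "nat \<Rightarrow> nat set"
    and h :: "nat \<Rightarrow> nat"
    and \<rho> :: "real \<Rightarrow> real"
    and x_st rho_st psi_st \<mu>\<^sub>0 \<sigma>\<^sub>0 lam \<xi> :: real
    and sigma_hat mu_hat :: "nat \<Rightarrow> 'a \<Rightarrow> real"
  assumes rho: "rho_condition \<rho> x_st rho_st psi_st"
    and psi_pos: "psi_st > 0"
    and sigma_pos: "\<sigma>\<^sub>0 > 0"
    and prob: "\<And>n. prob_space (M n)"
    and eps_meas: "\<And>n i. i \<in> {1..n} \<Longrightarrow> eps n i \<in> borel_measurable (M n)"
    and obs: "\<And>n i \<omega>. i \<in> {1..n} \<Longrightarrow> \<omega> \<in> space (M n) \<Longrightarrow> y n i \<omega> = \<mu>\<^sub>0 + \<sigma>\<^sub>0 * eps n i \<omega>"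
    and h_le: "\<And>n. h n \<le> n"
    and good_sub: "\<And>n. \<zeta> n \<subseteq> {1..n}"
    and good_card: "\<And>n. card (\<zeta> n) = h n"
    and h_inf: "filterlim h at_top sequentially"
    and h_ratio: "(\<lambda>n. real (h n) / real n) \<longlonglongrightarrow> lam"
    and lam_bounds: "1/2 < lam" "lam < 1"
    and scale: "\<And>n. AE \<omega> in M n. sigma_hat n \<omega> = \<sigma>\<^sub>0"
    and good_indep: "\<And>n. prob_space.indep_vars (M n) (\<lambda>_. borel) (eps n) (\<zeta> n)"
    and good_normal: "\<And>n i. i \<in> \<zeta> n \<Longrightarrow> distributed (M n) lborel (eps n i) std_normal_density"
    and ulln: "\<exists>U. open U \<and> 0 \<in> U \<and>
      unif_conv_in_prob M U
        (\<lambda>n \<mu> \<omega>. (\<Sum>i\<in>\<zeta> n. \<rho> (eps n i \<omega> - \<mu>)) / real (h n))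
        (\<lambda>\<mu>. LINT x|std_normal_distribution. \<rho> (x - \<mu>))"
    and deriv: "((\<lambda>\<mu>. LINT x|std_normal_distribution. \<rho> (x - \<mu>)) has_real_derivative 0) (at 0)"
    and xi_pos: "\<xi> > 0"
    and outliers: "\<And>n. \<zeta> n \<noteq> {} \<Longrightarrow>
      AE \<omega> in M n. \<forall>j \<in> {1..n} - \<zeta> n. eps n j \<omega> = (MAX i\<in>\<zeta> n. eps n i \<omega>) + \<xi>"
    and mu_hat_meas: "\<And>n. mu_hat n \<in> borel_measurable (M n)"
    and mu_hat_min: "\<And>n. AE \<omega> in M n.
      is_arg_min (m_objective \<rho> n (\<lambda>i. y n i \<omega>) (sigma_hat n \<omega>)) (\<lambda>_. True) (mu_hat n \<omega>)"
  shows "\<not> conv_in_prob M mu_hat \<mu>\<^sub>0"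
proof
  assume consistent: "conv_in_prob M mu_hat \<mu>\<^sub>0"
  define g where "g u = (LINT x|std_normal_distribution. \<rho> (x - u))" for u
  define G where "G n u \<omega> = (\<Sum>i\<in>\<zeta> n. \<rho> (eps n i \<omega> - u)) / real (h n)" for n u \<omega>
  obtain U where "open U" "0 \<in> U" and conv: "unif_conv_in_prob M U G g"
    using ulln unfolding G_def g_def by blast
  have cont: "continuous_on UNIV \<rho>" and "x_st > 0"
    and lin: "\<And>x. \<bar>x\<bar> \<ge> x_st \<Longrightarrow> \<rho> x = rho_st + psi_st * (\<bar>x\<bar> - x_st)"
    using rho by (auto simp: rho_condition_def)
  have [measurable]: "\<rho> \<in> borel_measurable borel"
    by (rule borel_measurable_continuous_onI[OF cont])
  have eps_good: "eps n i \<in> borel_measurable (M n)" if "i \<in> \<zeta> n" for n i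
    using that good_sub eps_meas by blast
  have G_meas [measurable]: "G n u \<in> borel_measurable (M n)" for n u
    unfolding G_def using eps_good by (intro borel_measurable_divide borel_measurable_sum) auto
  have gc: "continuous_on U g"
    using continuous_on_subset[OF expected_rho_continuous[OF rho]] by (auto simp: g_def [abs_def])
  have Gc: "continuous_on U (\<lambda>u. G n u \<omega>)" for n \<omega>
    unfolding G_def divide_inverse
    by (intro continuous_intros continuous_on_compose2[OF cont]) auto
  have pointwise: "(\<lambda>n. measure (M n) {\<omega> \<in> space (M n). \<bar>G n u \<omega> - g u\<bar> > e}) \<longlonglongrightarrow> 0"
    if "u \<in> U" "e > 0" for u e
    using that prob \<open>open U\<close> Gc gc
    by (intro unif_conv_in_prob_pointwise[OF conv] SUP_event_measurable prob_space.finite_measure) auto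

  \<comment> \<open>\<open>c\<close> is half the limit of \<open>psi_st * (n - h n) / h n\<close>,
    so it is eventually a lower bound for the outliers' slope per good observation.\<close>
  define c where "c = psi_st * ((1 - lam) / (2 * lam))"
  have "c > 0" using psi_pos lam_bounds by (simp add: c_def)
  have ev_ratio: "\<forall>\<^sub>F n in sequentially. (real n - real (h n)) * psi_st \<ge> c * real (h n)"
  proof -
    \<comment> \<open>\<open>2 * lam / (1 + lam)\<close> is the value of \<open>h n / n\<close> at
      which \<open>(n - h n) / h n\<close> equals \<open>(1 - lam) / (2 * lam)\<close>; it exceeds
      \<open>lam\<close> because \<open>lam < 1\<close>.\<close>
    have "lam < 2 * lam / (1 + lam)"
      using lam_bounds by (simp add: field_simps)
    then have "\<forall>\<^sub>F n in sequentially. real (h n) / real n < 2 * lam / (1 + lam)"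
      using h_ratio by (rule order_tendstoD(2)[rotated])
    moreover have "\<forall>\<^sub>F n in sequentially. n > 0" by (rule eventually_gt_at_top)
    ultimately show ?thesis
    proof eventually_elim
      case (elim n)
      have "real (h n) * (1 + lam) \<le> 2 * lam * real n"
        using elim lam_bounds by (simp add: field_simps)
      then have "(1 - lam) / (2 * lam) * real (h n) \<le> real n - real (h n)"
        using lam_bounds by (simp add: field_simps)
      then have "psi_st * ((1 - lam) / (2 * lam) * real (h n)) \<le> psi_st * (real n - real (h n))"
        using psi_pos by (intro mult_left_mono) auto
      then show ?case unfolding c_def by (simp only: mult_ac)
    qed
  qed

  \<comment> \<open>The zero derivative bounds the rise of \<open>g\<close> by any chosen fraction
    of \<open>u1\<close>; a quarter of the slope \<open>c\<close> leaves room for the errors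
    below.\<close>
  obtain u1 where "u1 > 0" "u1 \<in> U" and g_u1: "g u1 \<le> g 0 + c / 4 * u1"
  proof -
    obtain r where "r > 0" and r: "ball 0 r \<subseteq> U"
      using \<open>open U\<close> \<open>0 \<in> U\<close> open_contains_ball by blast
    have "(\<lambda>u. (g u - g 0) / (u - 0)) \<midarrow>0\<rightarrow> 0"
      using deriv by (simp add: has_field_derivative_iff g_def)
    then have "\<forall>\<^sub>F u in at 0. (g u - g 0) / u < c / 4"
      using order_tendstoD(2)[of "\<lambda>u. (g u - g 0) / u" 0 "at 0" "c / 4"] \<open>c > 0\<close>
      by (simp only: diff_zero)
    then obtain d where "d > 0" and d: "\<And>u. u \<noteq> 0 \<Longrightarrow> \<bar>u\<bar> < d \<Longrightarrow> (g u - g 0) / u < c / 4"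
      unfolding eventually_at by (auto simp: dist_real_def)
    define u where "u = min r d / 2"
    have "u > 0" "u < r" "u < d" using \<open>r > 0\<close> \<open>d > 0\<close> by (auto simp: u_def)
    then show ?thesis
      using r d[of u] by (intro that[of u]) (auto simp: field_simps subset_iff dist_real_def)
  qed
  \<comment> \<open>Error budget: three errors of size \<open>\<delta>\<close> plus the rise
    \<open>c / 4 * u1\<close> give \<open>5/8 * c * u1\<close>, below the outliers' gain of at least
    \<open>3/4 * c * u1\<close>.\<close>
  define \<delta> where "\<delta> = c * u1 / 8"
  have "\<delta> > 0" using \<open>c > 0\<close> \<open>u1 > 0\<close> by (simp add: \<delta>_def)
  \<comment> \<open>Within radius \<open>e\<close> the random minimizer can be replaced by 0 at cost
    \<open>\<delta>\<close>, and it stays at distance at least \<open>3/4 * u1\<close> from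
    \<open>u1\<close>.\<close>
  obtain e where "e > 0" "e \<le> u1 / 4" and e: "\<And>x s. \<bar>s\<bar> \<le> e \<Longrightarrow> \<rho> (x - s) \<ge> \<rho> x - \<delta>"
  proof -
    obtain d where "d > 0" and d: "\<And>x y. dist y x < d \<Longrightarrow> dist (\<rho> y) (\<rho> x) < \<delta>"
      using rho_uniformly_continuous[OF rho] \<open>\<delta> > 0\<close> unfolding uniformly_continuous_on_def
      by (metis UNIV_I)
    have "\<rho> (x - s) \<ge> \<rho> x - \<delta>" if "\<bar>s\<bar> \<le> min (d / 2) (u1 / 4)" for x s
      using d[of "x - s" x] that \<open>d > 0\<close> by (auto simp: dist_real_def)
    then show ?thesis
      using \<open>d > 0\<close> \<open>u1 > 0\<close> by (intro that[of "min (d / 2) (u1 / 4)"]) auto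
  qed
  \<comment> \<open>An outlier error above \<open>K\<close> keeps its residual in the linear region
    for every parameter up to \<open>u1\<close>.\<close>
  define K where "K = x_st + u1"

  \<comment> \<open>Bad events: the good average deviates at 0 (\<open>B\<close>) or at
    \<open>u1\<close> (\<open>C\<close>), the minimizer is far from the truth (\<open>D\<close>), or
    no good error exceeds \<open>K\<close> (\<open>E\<close>).\<close>
  define B where "B n = {\<omega> \<in> space (M n). \<bar>G n 0 \<omega> - g 0\<bar> > \<delta>}" for n
  define C where "C n = {\<omega> \<in> space (M n). \<bar>G n u1 \<omega> - g u1\<bar> > \<delta>}" for n
  define D where "D n = {\<omega> \<in> space (M n). \<bar>mu_hat n \<omega> - \<mu>\<^sub>0\<bar> > \<sigma>\<^sub>0 * e}" for n
  define E where "E n = (\<Inter>i\<in>\<zeta> n. eps n i -` {..K} \<inter> space (M n))" for n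
  have ev_h: "\<forall>\<^sub>F n in sequentially. h n > 0"
    by (rule eventually_compose_filterlim[OF eventually_gt_at_top h_inf])
  have nonempty: "\<zeta> n \<noteq> {}" if "h n > 0" for n
    using that good_card[of n] by auto
  have fin: "finite (\<zeta> n)" for n
    using good_sub[of n] finite_subset by blast
  have limE: "(\<lambda>n. measure (M n) (E n)) \<longlonglongrightarrow> 0"
  \<comment> \<open>The power formula is claimed only eventually: for \<open>h n = 0\<close> the
    empty intersection \<open>E n\<close> is \<open>UNIV\<close>.\<close>
  proof (rule Lim_transform_eventually)
    show "(\<lambda>n. measure std_normal_distribution {..K} ^ h n) \<longlonglongrightarrow> 0"
      using filterlim_compose[OF LIMSEQ_realpow_zero h_inf] std_normal_atMost_less_1 by simp
    show "\<forall>\<^sub>F n in sequentially. measure std_normal_distribution {..K} ^ h n = measure (M n) (E n)"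
      using ev_h
    proof eventually_elim
      case (elim n)
      then show ?case unfolding E_def
        using prob_all_std_normal_le[OF prob fin nonempty good_indep good_normal, of n K] good_card
        by simp
    qed
  qed
  have "(\<lambda>n. measure (M n) (B n) + measure (M n) (C n) + measure (M n) (D n) + measure (M n) (E n))
      \<longlonglongrightarrow> 0 + 0 + 0 + 0"
  proof (intro tendsto_add limE)
    show "(\<lambda>n. measure (M n) (D n)) \<longlonglongrightarrow> 0"
      using consistent \<open>e > 0\<close> sigma_pos by (simp add: conv_in_prob_def D_def)
  qed (use pointwise \<open>0 \<in> U\<close> \<open>u1 \<in> U\<close> \<open>\<delta> > 0\<close> in \<open>auto simp: B_def C_def\<close>)
  then have "\<forall>\<^sub>F n in sequentially.
      measure (M n) (B n) + measure (M n) (C n) + measure (M n) (D n) + measure (M n) (E n) < 1"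
    by (intro order_tendstoD(2)) auto
  \<comment> \<open>One such \<open>n\<close> suffices: the bad events will be shown to cover almost
    every outcome, so their probabilities must sum to at least 1.\<close>
  with ev_h ev_ratio obtain n where "h n > 0"
    and ratio: "(real n - real (h n)) * psi_st \<ge> c * real (h n)"
    and small: "measure (M n) (B n) + measure (M n) (C n) + measure (M n) (D n) + measure (M n) (E n) < 1"
    by (metis (mono_tags, lifting) eventually_conj eventually_happens' sequentially_bot)
  interpret P: prob_space "M n" by (rule prob)

  have "AE \<omega> in M n. \<omega> \<in> B n \<union> C n \<union> D n \<union> E n"
    using scale[of n] outliers[OF nonempty[OF \<open>h n > 0\<close>]] mu_hat_min[of n] AE_space
  proof eventually_elim
    case (elim \<omega>)
    show ?case
    proof (rule ccontr)
      assume "\<omega> \<notin> B n \<union> C n \<union> D n \<union> E n"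
      with elim have \<omega>: "\<bar>G n 0 \<omega> - g 0\<bar> \<le> \<delta>" "\<bar>G n u1 \<omega> - g u1\<bar> \<le> \<delta>"
        "\<bar>mu_hat n \<omega> - \<mu>\<^sub>0\<bar> \<le> \<sigma>\<^sub>0 * e" "\<exists>i\<in>\<zeta> n. eps n i \<omega> > K"
        using nonempty[OF \<open>h n > 0\<close>] by (auto simp: B_def C_def D_def E_def not_le)
      define u where "u = (mu_hat n \<omega> - \<mu>\<^sub>0) / \<sigma>\<^sub>0"
      have mu_u: "mu_hat n \<omega> = \<mu>\<^sub>0 + \<sigma>\<^sub>0 * u" using sigma_pos by (simp add: u_def)
      have "\<bar>u\<bar> \<le> e" using \<omega>(3) sigma_pos by (simp add: mu_u abs_mult)
      define X where "X = (MAX i\<in>\<zeta> n. eps n i \<omega>) + \<xi>"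
      have "X > K"
      proof -
        obtain i where "i \<in> \<zeta> n" "eps n i \<omega> > K" using \<omega>(4) by blast
        moreover from \<open>i \<in> \<zeta> n\<close> have "eps n i \<omega> \<le> (MAX i\<in>\<zeta> n. eps n i \<omega>)"
          using fin[of n] by (intro Max_ge) auto
        ultimately show ?thesis using xi_pos unfolding X_def by linarith
      qed
      have obj: "m_objective \<rho> n (\<lambda>i. y n i \<omega>) \<sigma>\<^sub>0 (\<mu>\<^sub>0 + \<sigma>\<^sub>0 * v)
          = (\<Sum>i\<in>\<zeta> n. \<rho> (eps n i \<omega> - v)) + (real n - real (h n)) * \<rho> (X - v)" for v
        unfolding good_card[symmetric]
        by (rule m_objective_standardised) (use sigma_pos good_sub obs elim in \<open>auto simp: X_def\<close>)
      have sumG: "(\<Sum>i\<in>\<zeta> n. \<rho> (eps n i \<omega> - v)) = real (h n) * G n v \<omega>" for v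
        using \<open>h n > 0\<close> by (simp add: G_def)
      \<comment> \<open>Minimality is used only against the competitor \<open>u1\<close>.\<close>
      have min: "real (h n) * G n u \<omega> + (real n - real (h n)) * \<rho> (X - u)
          \<le> real (h n) * G n u1 \<omega> + (real n - real (h n)) * \<rho> (X - u1)"
        using elim(1,3) obj[of u] obj[of u1] unfolding is_arg_min_def mu_u sumG
        by (metis not_less)
      have affine: "\<rho> (X - v) = rho_st + psi_st * (X - v - x_st)" if "v \<le> u1" for v
        using lin[of "X - v"] that \<open>X > K\<close> \<open>x_st > 0\<close> \<open>u1 > 0\<close> by (auto simp: K_def)
      have "u \<le> u1"
        using \<open>\<bar>u\<bar> \<le> e\<close> \<open>e \<le> u1 / 4\<close> \<open>u1 > 0\<close> by linarith
      have "(real n - real (h n)) * \<rho> (X - u) - (real n - real (h n)) * \<rho> (X - u1)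
          = ((real n - real (h n)) * psi_st) * (u1 - u)"
        unfolding affine[OF \<open>u \<le> u1\<close>] affine[OF order_refl] by (simp add: algebra_simps)
      also have "\<dots> \<ge> (c * real (h n)) * (u1 - u)"
        using ratio \<open>u \<le> u1\<close> by (intro mult_right_mono) auto
      finally have "real (h n) * (c * (u1 - u)) \<le> real (h n) * (G n u1 \<omega> - G n u \<omega>)"
        using min by (simp add: algebra_simps)
      then have gain: "c * (u1 - u) \<le> G n u1 \<omega> - G n u \<omega>"
        using \<open>h n > 0\<close> by simp
      \<comment> \<open>Since \<open>u\<close> depends on \<open>\<omega>\<close>, the law of large
        numbers is applied at the fixed point 0 and carried over to \<open>u\<close> term by
        term.\<close>
      have "real (h n) * (G n 0 \<omega> - \<delta>) = (\<Sum>i\<in>\<zeta> n. \<rho> (eps n i \<omega>) - \<delta>)"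
        using sumG[of 0] good_card[of n] by (simp add: sum_subtractf algebra_simps)
      also have "\<dots> \<le> (\<Sum>i\<in>\<zeta> n. \<rho> (eps n i \<omega> - u))"
        by (intro sum_mono e \<open>\<bar>u\<bar> \<le> e\<close>)
      finally have "G n 0 \<omega> - \<delta> \<le> G n u \<omega>"
        using \<open>h n > 0\<close> by (simp add: sumG)
      moreover have "c * (3 / 4 * u1) \<le> c * (u1 - u)"
        using \<open>c > 0\<close> \<open>\<bar>u\<bar> \<le> e\<close> \<open>e \<le> u1 / 4\<close> by (intro mult_left_mono) auto
      moreover have "c * u1 > 0" using \<open>c > 0\<close> \<open>u1 > 0\<close> by simp
      \<comment> \<open>The chain \<open>3/4 * c * u1 \<le> G n u1 \<omega> - G n u \<omega> \<le> c
        / 4 * u1 + 3 * \<delta> = 5/8 * c * u1\<close> is impossible.\<close>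
      ultimately show False
        using gain g_u1 \<omega>(1,2) unfolding \<delta>_def by (simp add: abs_le_iff)
    qed
  qed
  moreover have sets: "B n \<in> P.events" "C n \<in> P.events" "D n \<in> P.events" "E n \<in> P.events"
    unfolding B_def C_def D_def E_def
    using mu_hat_meas[of n] nonempty[OF \<open>h n > 0\<close>] fin[of n] eps_good[of _ n]
    by (auto intro!: sets.finite_INT measurable_sets[where A = borel])
  ultimately have "P.prob (B n \<union> C n \<union> D n \<union> E n) = 1"
    by (subst P.prob_eq_1) auto
  moreover have "P.prob (B n \<union> C n \<union> D n \<union> E n)
      \<le> P.prob (B n) + P.prob (C n) + P.prob (D n) + P.prob (E n)"
    using sets measure_Un_le[of "B n \<union> C n \<union> D n" "M n" "E n"]
      measure_Un_le[of "B n \<union> C n" "M n" "D n"] measure_Un_le[of "B n" "M n" "C n"]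
    by auto
  ultimately show False using small by linarith
qed

end
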